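(* Let $m,p\ge 1$ and let $$T=\begin{bmatrix}T_1 & R\\ 0 & T_2\end{bmatrix}\in M_{m+p},$$ where $T_1\in M_m$ is invertible, $T_2\in M_p$ is nilpotent, and $R$ is an $m\times p$ complex matrix. Then $T$ is a product of three positive semi-definite matrices if and only if one of the following holds. (a) $R\neq 0$ or $T_2\neq 0$. (b) $R=0$, $T_2=0$, and $T_1$ is the product of three positive definite matrices.
   Context: $M_n$ denotes the set of $n\times n$ complex matrices. Positive semi-definite (respectively positive definite) matrices are complex Hermitian matrices $P$ with $x^*Px\ge 0$ for all vectors $x$ (respectively $x^*Px>0$ for all nonzero $x$). The factors in a product are square matrices of the same size as the product; they are not required to be distinct. *)

theory Defs
  imports "Jordan_Normal_Form.Schur_Decomposition"
begin

(* On complex numbers, 0 <= z and 0 < z of HOL-Library.Complex_Order include Im z = 0.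
   The form (P x) \<bullet>c x is the sum of (P x)_i * cnj (x_i), i.e. x^* P x. *)

definition pos_semidef_mat :: "nat \<Rightarrow> complex mat \<Rightarrow> bool" where
  "pos_semidef_mat n P \<longleftrightarrow>
     P \<in> carrier_mat n n \<and> mat_adjoint P = P \<and>
     (\<forall>x \<in> carrier_vec n. 0 \<le> (P *\<^sub>v x) \<bullet>c x)"

definition pos_def_mat :: "nat \<Rightarrow> complex mat \<Rightarrow> bool" where
  "pos_def_mat n P \<longleftrightarrow>
     P \<in> carrier_mat n n \<and> mat_adjoint P = P \<and>
     (\<forall>x \<in> carrier_vec n. x \<noteq> 0\<^sub>v n \<longrightarrow> 0 < (P *\<^sub>v x) \<bullet>c x)"

definition product_of_three :: "(complex mat \<Rightarrow> bool) \<Rightarrow> complex mat \<Rightarrow> bool" where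
  "product_of_three Q A \<longleftrightarrow> (\<exists>P1 P2 P3. Q P1 \<and> Q P2 \<and> Q P3 \<and> A = P1 * P2 * P3)"

definition nilpotent_mat :: "'a :: semiring_1 mat \<Rightarrow> bool" where
  "nilpotent_mat A \<longleftrightarrow>
     square_mat A \<and> (\<exists>k. A ^\<^sub>m k = 0\<^sub>m (dim_row A) (dim_row A))"

end

theory Submission
  imports Defs
begin

text \<open>
  Both directions rest on the fact that \<open>P \<mapsto> X\<^sup>* P X\<close> preserves positive semi-definiteness.

  \<^item> If \<open>R = 0\<close> and \<open>T2 = 0\<close>, then \<open>T = X\<^sup>* T1 X\<close> with \<open>X = [I 0]\<close>, and
    \<open>product_of_three_compression\<close> shows that such a \<open>T\<close> is a product of three positive
    semi-definite matrices exactly if \<open>T1\<close> is a product of three positive definite ones.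
    Given \<open>T = P1 P2 P3\<close>, the columns of \<open>X\<^sup>*\<close> lie in the ranges of \<open>P1\<close> and of \<open>P3\<close>, say
    \<open>P1 Y1 = X\<^sup>* = P3 Y3\<close>. Evaluating \<open>Y1\<^sup>* P1 P2 P3 Y3\<close> in two ways gives
    \<open>X P2 X\<^sup>* = S1 T1 S3\<close> with \<open>Si = Yi\<^sup>* Pi Yi\<close>, and all three matrices \<open>S1\<close>, \<open>S3\<close> and
    \<open>X P2 X\<^sup>*\<close> are positive definite.

  \<^item> Otherwise \<open>T\<close> always factors. It suffices that some congruent matrix \<open>S\<^sup>* T S\<close> is
    diagonalizable with nonnegative eigenvalues, \<open>S\<^sup>* T S = Q D Q\<^sup>-\<^sup>1\<close>: with \<open>U = S Q\<close>,
    \<open>T = (S\<^sup>-\<^sup>* S\<^sup>-\<^sup>1) (U D U\<^sup>*) (U\<^sup>-\<^sup>* U\<^sup>-\<^sup>1)\<close>.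
    The condition \<open>R \<noteq> 0\<close> or \<open>T2 \<noteq> 0\<close> provides a vector \<open>k\<close> with \<open>T k = 0\<close> and
    \<open>g = T\<^sup>* k \<noteq> 0\<close> (\<open>block_kernel_moved\<close>). Replacing \<open>s\<close> by \<open>s + \<kappa> k\<close> leaves \<open>T s\<close> alone but
    shifts the value \<open>s\<^sup>* T s\<close> by an arbitrary amount, as long as \<open>g\<^sup>* s \<noteq> 0\<close>; so the diagonal
    entries of \<open>S\<^sup>* T S\<close> can be prescribed one after the other. In each step \<open>s\<close> becomes the first
    basis vector and the other ones are taken orthogonal to \<open>T\<^sup>* s\<close>, so that the first row becomes
    \<open>(a, 0, ..., 0)\<close> and the remaining corner \<open>N\<close> is again zero or has a kernel vector that its
    adjoint does not annihilate. The corner is treated by induction with eigenvalues below \<open>a\<close>, and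
    because \<open>a\<close> is not an eigenvalue of the corner, the block triangular matrix is diagonalizable.
\<close>

section \<open>Adjoints and inverses\<close>

lemma mat_adjoint_dim [simp]: "dim_row (mat_adjoint A) = dim_col A" "dim_col (mat_adjoint A) = dim_row A"
  by (auto simp: mat_adjoint_def)

lemma mat_adjoint_carrier [simp]: "A \<in> carrier_mat n m \<Longrightarrow> mat_adjoint A \<in> carrier_mat m n"
  by (rule carrier_matI) simp_all

lemma mat_adjoint_index [simp]:
  fixes A :: "complex mat"
  assumes "i < dim_col A" "j < dim_row A"
  shows "mat_adjoint A $$ (i, j) = cnj (A $$ (j, i))"
  using assms by (auto simp: mat_adjoint_def mat_of_rows_def)

lemma mat_adjoint_mult:
  fixes A B :: "complex mat"
  assumes "A \<in> carrier_mat n m" "B \<in> carrier_mat m l"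
  shows "mat_adjoint (A * B) = mat_adjoint B * mat_adjoint A"
  using assms by (intro eq_matI) (auto simp: scalar_prod_def mult.commute)

lemma mat_adjoint_adjoint [simp]: "mat_adjoint (mat_adjoint A) = (A :: complex mat)"
  by (intro eq_matI) auto

lemma mat_adjoint_one [simp]: "mat_adjoint (1\<^sub>m n) = (1\<^sub>m n :: complex mat)"
  by (intro eq_matI) auto

lemma mat_adjoint_zero [simp]: "mat_adjoint (0\<^sub>m n m) = (0\<^sub>m m n :: complex mat)"
  by (intro eq_matI) auto

lemma mat_adjoint_four_block:
  fixes A B C D :: "complex mat"
  assumes "A \<in> carrier_mat n1 m1" "B \<in> carrier_mat n1 m2" "C \<in> carrier_mat n2 m1" "D \<in> carrier_mat n2 m2"
  shows "mat_adjoint (four_block_mat A B C D) =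
    four_block_mat (mat_adjoint A) (mat_adjoint C) (mat_adjoint B) (mat_adjoint D)"
  using assms by (intro eq_matI) auto

lemma mat_adjoint_scalar_prod:
  fixes A :: "complex mat"
  assumes "A \<in> carrier_mat n m" "v \<in> carrier_vec m" "w \<in> carrier_vec n"
  shows "(A *\<^sub>v v) \<bullet>c w = v \<bullet>c (mat_adjoint A *\<^sub>v w)"
proof -
  have "(A *\<^sub>v v) \<bullet>c w = (\<Sum>i<n. \<Sum>j<m. A $$ (i, j) * v $ j * cnj (w $ i))"
    using assms by (simp add: scalar_prod_def sum_distrib_right atLeast0LessThan)
  also have "\<dots> = (\<Sum>j<m. \<Sum>i<n. A $$ (i, j) * v $ j * cnj (w $ i))"
    by (rule sum.swap)
  also have "\<dots> = v \<bullet>c (mat_adjoint A *\<^sub>v w)"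
    using assms by (simp add: scalar_prod_def sum_distrib_left atLeast0LessThan algebra_simps)
  finally show ?thesis .
qed

lemma mat_diag_adjoint_real:
  "mat_adjoint (mat_diag n (\<lambda>i. complex_of_real (d i))) = mat_diag n (\<lambda>i. complex_of_real (d i))"
  by (intro eq_matI) (auto simp: mat_diag_def)

text \<open>
  With the dimensions as side conditions, instead of carrier sets whose inner dimension has to be
  guessed, associativity can be used as a rewrite rule.
\<close>

lemma mult_mat_assoc:
  "dim_col A = dim_row B \<Longrightarrow> dim_col B = dim_row C \<Longrightarrow> (A * B) * C = A * (B * C)"
  for A :: "'a :: semiring_0 mat"
  by (rule assoc_mult_mat[of _ "dim_row A" "dim_row B" _ "dim_row C" _ "dim_col C"]) auto

text \<open>The shape in which inverses meet in products that are fully associated to the right.\<close>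

lemma mult_cancel_inverse:
  fixes A B Z :: "'a :: semiring_1 mat"
  assumes "A * B = 1\<^sub>m n" "dim_col A = dim_row B" "dim_row Z = n"
  shows "A * (B * Z) = Z"
proof -
  have "dim_col B = n" using arg_cong[OF assms(1), of dim_col] by simp
  then have "A * (B * Z) = A * B * Z" using assms by (intro mult_mat_assoc[symmetric]) auto
  then show ?thesis using assms by (metis carrier_matI left_mult_one_mat)
qed

lemma obtain_inverse_mat:
  fixes A :: "'a :: field mat"
  assumes "A \<in> carrier_mat n n" "det A \<noteq> 0"
  obtains B where "B \<in> carrier_mat n n" "A * B = 1\<^sub>m n" "B * A = 1\<^sub>m n" "det B \<noteq> 0"
proof -
  from det_non_zero_imp_unit[OF assms, of "()"] obtain B where
    B: "B \<in> carrier_mat n n" "A * B = 1\<^sub>m n" "B * A = 1\<^sub>m n"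
    by (auto simp: Units_def ring_mat_def)
  from arg_cong[OF B(2), of det] have "det B \<noteq> 0"
    using det_mult[OF assms(1) B(1)] by auto
  with B that show ?thesis by blast
qed

lemma det_nz_if_invertible:
  fixes A :: "'a :: field mat"
  assumes A: "A \<in> carrier_mat n n" and inv: "invertible_mat A"
  shows "det A \<noteq> 0"
proof -
  obtain B where B: "A * B = 1\<^sub>m n" "B * A = 1\<^sub>m (dim_row B)"
    using inv A unfolding invertible_mat_def inverts_mat_def by auto
  have "dim_col B = n" using arg_cong[OF B(1), of dim_col] by simp
  moreover have "dim_row B = n" using arg_cong[OF B(2), of dim_col] A by simp
  ultimately have "B \<in> carrier_mat n n" by (intro carrier_matI)
  from det_mult[OF A this] B(1) show ?thesis by (metis det_one mult_zero_left zero_neq_one)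
qed

lemma det_mat_adjoint_nz:
  fixes A :: "complex mat"
  assumes "A \<in> carrier_mat n n" "det A \<noteq> 0"
  shows "det (mat_adjoint A) \<noteq> 0"
proof -
  obtain B where B: "B \<in> carrier_mat n n" "A * B = 1\<^sub>m n"
    using obtain_inverse_mat[OF assms] by metis
  then have "mat_adjoint B * mat_adjoint A = 1\<^sub>m n"
    using mat_adjoint_mult[OF assms(1) B(1)] by simp
  then show ?thesis
    using det_mult[OF mat_adjoint_carrier[OF B(1)] mat_adjoint_carrier[OF assms(1)]]
    by (metis det_one mult_zero_right zero_neq_one)
qed

lemma mult_mat_zero_vec:
  fixes A :: "'a :: semiring_0 mat"
  assumes "A \<in> carrier_mat n m"
  shows "A *\<^sub>v 0\<^sub>v m = 0\<^sub>v n"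
  using assms by (intro eq_vecI) (auto simp: carrier_matD[OF assms])

lemma mult_mat_vec_inj:
  fixes A :: "complex mat"
  assumes A: "A \<in> carrier_mat n n" "det A \<noteq> 0" and v: "v \<in> carrier_vec n" "w \<in> carrier_vec n"
    and eq: "A *\<^sub>v v = A *\<^sub>v w"
  shows "v = w"
proof -
  obtain B where B: "B \<in> carrier_mat n n" "B * A = 1\<^sub>m n"
    using obtain_inverse_mat[OF A] by metis
  have "v = (B * A) *\<^sub>v v" "w = (B * A) *\<^sub>v w" using B v by auto
  then show ?thesis using eq assoc_mult_mat_vec[OF B(1) A(1)] v by metis
qed

lemma det_nz_if_injective:
  fixes A :: "complex mat"
  assumes A: "A \<in> carrier_mat n n" and inj: "\<And>v. v \<in> carrier_vec n \<Longrightarrow> A *\<^sub>v v = 0\<^sub>v n \<Longrightarrow> v = 0\<^sub>v n"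
  shows "det A \<noteq> 0"
  using det_0_iff_vec_prod_zero_field[OF A] inj by auto

lemma mat_zero_if_kills_all:
  fixes A :: "complex mat"
  assumes A: "A \<in> carrier_mat n m" and z: "\<And>v. v \<in> carrier_vec m \<Longrightarrow> A *\<^sub>v v = 0\<^sub>v n"
  shows "A = 0\<^sub>m n m"
proof (rule eq_matI)
  fix i j assume "i < dim_row (0\<^sub>m n m :: complex mat)" "j < dim_col (0\<^sub>m n m :: complex mat)"
  then have ij: "i < n" "j < m" by auto
  have "A $$ (i, j) = (A *\<^sub>v unit_vec m j) $ i" using ij A by (auto simp: scalar_prod_right_unit)
  also have "\<dots> = 0" using z[of "unit_vec m j"] ij by simp
  finally show "A $$ (i, j) = 0\<^sub>m n m $$ (i, j)" using ij by simp
qed (use A in auto)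

section \<open>Positive semi-definite matrices\<close>

lemma pos_semidef_congruence:
  assumes P: "pos_semidef_mat n P" and X: "X \<in> carrier_mat n m"
  shows "pos_semidef_mat m (mat_adjoint X * P * X)"
proof -
  have Pc: "P \<in> carrier_mat n n" and h: "mat_adjoint P = P" using P by (auto simp: pos_semidef_mat_def)
  let ?Y = "mat_adjoint X * P * X"
  have "mat_adjoint ?Y = mat_adjoint X * mat_adjoint (mat_adjoint X * P)"
    using Pc X by (subst mat_adjoint_mult[of _ m n _ m]) auto
  also have "mat_adjoint (mat_adjoint X * P) = P * X"
    using Pc X h by (subst mat_adjoint_mult[of _ m n _ n]) auto
  also have "mat_adjoint X * (P * X) = ?Y"
    using Pc X by (subst assoc_mult_mat[of _ m n _ n _ m]) auto
  finally have "mat_adjoint ?Y = ?Y" .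
  moreover have "0 \<le> (?Y *\<^sub>v x) \<bullet>c x" if x: "x \<in> carrier_vec m" for x
  proof -
    have "?Y *\<^sub>v x = mat_adjoint X *\<^sub>v (P *\<^sub>v (X *\<^sub>v x))"
      using assoc_mult_mat_vec[of "mat_adjoint X * P" m n X m x] assoc_mult_mat_vec[of "mat_adjoint X" m n P n "X *\<^sub>v x"]
        Pc X x by (metis mat_adjoint_carrier mult_carrier_mat mult_mat_vec_carrier)
    then have "(?Y *\<^sub>v x) \<bullet>c x = (P *\<^sub>v (X *\<^sub>v x)) \<bullet>c (X *\<^sub>v x)"
      using Pc X x mat_adjoint_scalar_prod[of "mat_adjoint X" m n "P *\<^sub>v (X *\<^sub>v x)" x] by auto
    then show ?thesis using P X x by (auto simp: pos_semidef_mat_def)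
  qed
  moreover have "?Y \<in> carrier_mat m m"
    by (intro mult_carrier_mat[of _ m n] mat_adjoint_carrier Pc X)
  ultimately show ?thesis unfolding pos_semidef_mat_def by blast
qed

lemma pos_semidef_diag:
  assumes "\<And>i. i < n \<Longrightarrow> 0 \<le> d i"
  shows "pos_semidef_mat n (mat_diag n (\<lambda>i. complex_of_real (d i)))" (is "pos_semidef_mat n ?D")
proof -
  have "0 \<le> (?D *\<^sub>v x) \<bullet>c x" if x: "x \<in> carrier_vec n" for x
  proof -
    have "(?D *\<^sub>v x) $ i = of_real (d i) * x $ i" if "i < n" for i
      using that x by (simp add: mat_diag_def scalar_prod_def if_distrib[of "\<lambda>y. y * _"] sum.delta cong: if_cong)
    then have "(?D *\<^sub>v x) \<bullet>c x = (\<Sum>i<n. of_real (d i) * (x $ i * cnj (x $ i)))"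
      using x by (simp add: scalar_prod_def[of _ "conjugate x"] atLeast0LessThan algebra_simps)
    also have "\<dots> \<ge> 0"
    proof (intro sum_nonneg)
      fix i assume "i \<in> {..<n}"
      then have "0 \<le> complex_of_real (d i)" using assms by (simp add: less_eq_complex_def)
      moreover have "0 \<le> x $ i * cnj (x $ i)"
        by (simp only: complex_mult_cnj) (simp add: less_eq_complex_def)
      ultimately show "0 \<le> of_real (d i) * (x $ i * cnj (x $ i))" by (rule mult_nonneg_nonneg)
    qed
    finally show ?thesis .
  qed
  then show ?thesis unfolding pos_semidef_mat_def using mat_diag_adjoint_real mat_diag_dim by blast
qed

lemma pos_semidef_one: "pos_semidef_mat n (1\<^sub>m n)"
  using pos_semidef_diag[of n "\<lambda>_. 1"] by simp

lemma pos_semidef_gram: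
  assumes "X \<in> carrier_mat n m"
  shows "pos_semidef_mat m (mat_adjoint X * X)"
  using pos_semidef_congruence[OF pos_semidef_one assms] assms by simp

text \<open>
  With \<open>y = P x\<close>, the form takes the value \<open>t\<^sup>2 y\<^sup>*Py - 2 t y\<^sup>*y\<close> at \<open>x - t y\<close>, which is negative for
  small \<open>t > 0\<close> unless \<open>y = 0\<close>.
\<close>

lemma pos_semidef_kernel:
  assumes P: "pos_semidef_mat n P" and x: "x \<in> carrier_vec n" and z: "(P *\<^sub>v x) \<bullet>c x = 0"
  shows "P *\<^sub>v x = 0\<^sub>v n"
proof (rule ccontr)
  assume ne: "P *\<^sub>v x \<noteq> 0\<^sub>v n"
  have Pc: "P \<in> carrier_mat n n" and h: "mat_adjoint P = P" using P by (auto simp: pos_semidef_mat_def)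
  define y where "y = P *\<^sub>v x"
  have y: "y \<in> carrier_vec n" using Pc x by (auto simp: y_def)
  have nn: "0 \<le> (P *\<^sub>v v) \<bullet>c v" if "v \<in> carrier_vec n" for v using P that by (auto simp: pos_semidef_mat_def)
  define \<alpha> where "\<alpha> = Re (y \<bullet>c y)"
  define \<beta> where "\<beta> = Re ((P *\<^sub>v y) \<bullet>c y)"
  have ya: "y \<bullet>c y = of_real \<alpha>" "0 < \<alpha>"
    using conjugate_square_greater_0_vec[OF y] ne y_def by (auto simp: \<alpha>_def less_complex_def complex_eq_iff)
  have yb: "(P *\<^sub>v y) \<bullet>c y = of_real \<beta>" "0 \<le> \<beta>"
    using nn[OF y] by (auto simp: \<beta>_def less_eq_complex_def complex_eq_iff)
  \<comment> \<open>small enough for \<open>t \<beta> < 2 \<alpha>\<close>; the summand 1 covers \<open>\<beta> = 0\<close>\<close>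
  define t where "t = \<alpha> / (\<beta> + 1)"
  let ?v = "x - of_real t \<cdot>\<^sub>v y"
  have ty: "of_real t \<cdot>\<^sub>v y \<in> carrier_vec n" using y by auto
  have Pv: "P *\<^sub>v ?v = y - of_real t \<cdot>\<^sub>v (P *\<^sub>v y)"
    using Pc x y ty by (simp add: mult_minus_distrib_mat_vec mult_mat_vec y_def)
  have cj: "conjugate ?v = conjugate x - of_real t \<cdot>\<^sub>v conjugate y"
    using x y by (intro eq_vecI) auto
  have yx: "y \<bullet>c x = 0" using z y_def by simp
  have Pyx: "(P *\<^sub>v y) \<bullet>c x = y \<bullet>c y"
    using mat_adjoint_scalar_prod[OF Pc y x] h y_def by simp
  have "(P *\<^sub>v ?v) \<bullet>c ?v = (y - of_real t \<cdot>\<^sub>v (P *\<^sub>v y)) \<bullet>c x - of_real t * ((y - of_real t \<cdot>\<^sub>v (P *\<^sub>v y)) \<bullet>c y)"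
    unfolding Pv cj using x y Pc by (subst scalar_prod_minus_distrib[of _ n]) auto
  also have "\<dots> = (y \<bullet>c x - of_real t * ((P *\<^sub>v y) \<bullet>c x)) - of_real t * (y \<bullet>c y - of_real t * ((P *\<^sub>v y) \<bullet>c y))"
    using x y Pc by (simp add: minus_scalar_prod_distrib[of _ n])
  also have "\<dots> = of_real (t\<^sup>2 * \<beta> - 2 * t * \<alpha>)"
    unfolding yx Pyx ya yb by (simp add: power2_eq_square algebra_simps)
  finally have "0 \<le> t\<^sup>2 * \<beta> - 2 * t * \<alpha>"
    using nn[of ?v] x y by (simp add: less_eq_complex_def)
  moreover have tp: "0 < t" using ya yb by (simp add: t_def)
  moreover have "t * \<beta> < 2 * \<alpha>"
  proof -
    have "t * (\<beta> + 1) = \<alpha>" using yb by (simp add: t_def)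
    then have "t * \<beta> = \<alpha> - t" by (simp add: algebra_simps)
    with tp ya show ?thesis by simp
  qed
  then have "t * (t * \<beta>) < t * (2 * \<alpha>)" using tp by (rule mult_strict_left_mono)
  ultimately show False by (simp add: power2_eq_square algebra_simps)
qed

lemma pos_def_if_pos_semidef_det_nz:
  assumes P: "pos_semidef_mat n P" and d: "det P \<noteq> 0"
  shows "pos_def_mat n P"
proof -
  have Pc: "P \<in> carrier_mat n n" using P by (auto simp: pos_semidef_mat_def)
  have P0: "P *\<^sub>v 0\<^sub>v n = 0\<^sub>v n" using mult_mat_zero_vec[OF Pc] .
  have "0 < (P *\<^sub>v x) \<bullet>c x" if x: "x \<in> carrier_vec n" "x \<noteq> 0\<^sub>v n" for x
  proof -
    have "P *\<^sub>v x \<noteq> 0\<^sub>v n" using mult_mat_vec_inj[OF Pc d x(1) zero_carrier_vec] x(2) P0 by metis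
    then have "(P *\<^sub>v x) \<bullet>c x \<noteq> 0" using pos_semidef_kernel[OF P x(1)] by metis
    moreover have "0 \<le> (P *\<^sub>v x) \<bullet>c x" using P x by (simp add: pos_semidef_mat_def)
    ultimately show ?thesis by (metis order.not_eq_order_implies_strict)
  qed
  then show ?thesis using P by (simp add: pos_semidef_mat_def pos_def_mat_def)
qed

lemma pos_semidef_if_pos_def: "pos_def_mat n P \<Longrightarrow> pos_semidef_mat n P"
  unfolding pos_semidef_mat_def pos_def_mat_def
  by (metis carrier_matD(1) conjugate_zero_vec mult_mat_vec_carrier order.strict_implies_order order_refl
      scalar_prod_right_zero)

text \<open>The inverse \<open>Y\<close> of \<open>P\<close> is the congruent matrix \<open>Y\<^sup>* P Y\<close>.\<close>

lemma pos_def_inverse: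
  assumes P: "pos_semidef_mat n P" and Y: "Y \<in> carrier_mat n n" "P * Y = 1\<^sub>m n"
  shows "pos_def_mat n Y"
proof -
  have Pc: "P \<in> carrier_mat n n" using P by (auto simp: pos_semidef_mat_def)
  have YP: "Y * P = 1\<^sub>m n" using mat_mult_left_right_inverse[OF Pc Y] .
  have aYP: "mat_adjoint Y * P = 1\<^sub>m n"
    using mat_adjoint_mult[OF Pc Y(1)] Y(2) P by (simp add: pos_semidef_mat_def)
  have "mat_adjoint Y * P * Y = Y" using aYP Y by simp
  moreover have "det Y \<noteq> 0"
    using det_mult[OF Pc Y(1)] Y(2) by auto
  ultimately show ?thesis
    using pos_semidef_congruence[OF P Y(1)] pos_def_if_pos_semidef_det_nz by metis
qed


lemma pos_def_det_nz:
  assumes P: "pos_def_mat n P"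
  shows "det P \<noteq> 0"
proof (rule det_nz_if_injective)
  show Pc: "P \<in> carrier_mat n n" using P by (simp add: pos_def_mat_def)
  fix v :: "complex vec" assume v: "v \<in> carrier_vec n" "P *\<^sub>v v = 0\<^sub>v n"
  then have "(P *\<^sub>v v) \<bullet>c v = 0" by simp
  then show "v = 0\<^sub>v n" using P v(1) unfolding pos_def_mat_def by force
qed

section \<open>Compression to a nonsingular corner\<close>

text \<open>
  If \<open>Y\<^sup>* P Y\<close> annihilates \<open>v\<close>, then the form of \<open>P\<close> vanishes at \<open>Y v\<close>, hence \<open>P Y v = 0\<close>, and the left
  inverse \<open>X\<close> of \<open>P Y\<close> gives \<open>v = 0\<close>.
\<close>

lemma pos_def_congruence:
  assumes P: "pos_semidef_mat n P" and Y: "Y \<in> carrier_mat n m" and X: "X \<in> carrier_mat m n"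
    and XPY: "X * (P * Y) = 1\<^sub>m m"
  shows "pos_def_mat m (mat_adjoint Y * P * Y)"
proof (rule pos_def_if_pos_semidef_det_nz[OF pos_semidef_congruence[OF P Y]], rule det_nz_if_injective)
  have Pc: "P \<in> carrier_mat n n" using P by (simp add: pos_semidef_mat_def)
  have PY: "P * Y \<in> carrier_mat n m" using Pc Y by simp
  show "mat_adjoint Y * P * Y \<in> carrier_mat m m"
    by (intro mult_carrier_mat[of _ m n] mat_adjoint_carrier Pc Y)
  fix v assume v: "v \<in> carrier_vec m" and z: "(mat_adjoint Y * P * Y) *\<^sub>v v = 0\<^sub>v m"
  have Yv: "Y *\<^sub>v v \<in> carrier_vec n" using Y v by simp
  have PYv: "P *\<^sub>v (Y *\<^sub>v v) = (P * Y) *\<^sub>v v"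
    using assoc_mult_mat_vec[OF Pc Y v] by simp
  have "mat_adjoint Y * P * Y = mat_adjoint Y * (P * Y)"
    using Pc Y by (intro mult_mat_assoc) auto
  then have "mat_adjoint Y *\<^sub>v (P *\<^sub>v (Y *\<^sub>v v)) = 0\<^sub>v m"
    using z PYv assoc_mult_mat_vec[OF mat_adjoint_carrier[OF Y] PY v] by simp
  then have "(P *\<^sub>v (Y *\<^sub>v v)) \<bullet>c (Y *\<^sub>v v) = 0"
    using mat_adjoint_scalar_prod[OF mat_adjoint_carrier[OF Y], of "P *\<^sub>v (Y *\<^sub>v v)" v] Pc Yv v
    by simp
  then have "(P * Y) *\<^sub>v v = 0\<^sub>v n"
    using pos_semidef_kernel[OF P Yv] PYv by simp
  then have "X *\<^sub>v 0\<^sub>v n = v"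
    using assoc_mult_mat_vec[OF X PY v] XPY v by simp
  moreover have "X *\<^sub>v 0\<^sub>v n = 0\<^sub>v m" using mult_mat_zero_vec[OF X] .
  ultimately show "v = 0\<^sub>v m" by simp
qed

text \<open>
  The hypothesis says that \<open>X\<close> is a coisometry, so \<open>X\<^sup>* A X\<close> acts as \<open>A\<close> on an \<open>m\<close>-dimensional subspace
  and as zero on its orthogonal complement. Factors of \<open>X\<^sup>* A X\<close> can be singular and need not respect
  this decomposition; the ranges of the outer ones still contain the subspace, because
  \<open>P1 P2 P3 X\<^sup>* A\<^sup>-\<^sup>1 = X\<^sup>*\<close> and, by taking adjoints, \<open>P3 P2 P1 X\<^sup>* A\<^sup>-\<^sup>* = X\<^sup>*\<close>.
\<close>

lemma product_of_three_compression:
  assumes X: "X \<in> carrier_mat m n" and XX: "X * mat_adjoint X = 1\<^sub>m m"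
    and A: "A \<in> carrier_mat m m" and dA: "det A \<noteq> 0"
  shows "product_of_three (pos_semidef_mat n) (mat_adjoint X * A * X) \<longleftrightarrow>
    product_of_three (pos_def_mat m) A"
proof
  have XXZ: "X * (mat_adjoint X * Z) = Z" if "dim_row Z = m" for Z
    using mult_cancel_inverse[OF XX _ that] by simp
  note dX = carrier_matD[OF X]
  {
    assume "product_of_three (pos_def_mat m) A"
    then obtain Q1 Q2 Q3 where Q: "pos_def_mat m Q1" "pos_def_mat m Q2" "pos_def_mat m Q3"
      and AQ: "A = Q1 * Q2 * Q3" unfolding product_of_three_def by blast
    have c: "Q1 \<in> carrier_mat m m" "Q2 \<in> carrier_mat m m" "Q3 \<in> carrier_mat m m"
      using Q by (simp_all add: pos_def_mat_def)
    note d = carrier_matD[OF c(1)] carrier_matD[OF c(2)] carrier_matD[OF c(3)]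
    have "mat_adjoint X * A * X = (mat_adjoint X * Q1 * X) * (mat_adjoint X * Q2 * X) * (mat_adjoint X * Q3 * X)"
      unfolding AQ by (simp add: mult_mat_assoc d dX XXZ)
    moreover have "pos_semidef_mat n (mat_adjoint X * Q * X)" if "pos_def_mat m Q" for Q
      using pos_semidef_congruence[OF pos_semidef_if_pos_def[OF that] X] .
    ultimately show "product_of_three (pos_semidef_mat n) (mat_adjoint X * A * X)"
      unfolding product_of_three_def using Q by blast
  }
  assume "product_of_three (pos_semidef_mat n) (mat_adjoint X * A * X)"
  then obtain P1 P2 P3 where P: "pos_semidef_mat n P1" "pos_semidef_mat n P2" "pos_semidef_mat n P3"
    and eq: "mat_adjoint X * A * X = P1 * P2 * P3" unfolding product_of_three_def by blast
  have c: "P1 \<in> carrier_mat n n" "P2 \<in> carrier_mat n n" "P3 \<in> carrier_mat n n"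
    and h: "mat_adjoint P1 = P1" "mat_adjoint P2 = P2" "mat_adjoint P3 = P3"
    using P by (simp_all add: pos_semidef_mat_def)
  obtain B where B: "B \<in> carrier_mat m m" "A * B = 1\<^sub>m m" "B * A = 1\<^sub>m m"
    using obtain_inverse_mat[OF A dA] by metis
  note d = carrier_matD[OF c(1)] carrier_matD[OF c(2)] carrier_matD[OF c(3)]
    carrier_matD[OF A] carrier_matD[OF B(1)] dX
  have eqZ: "P1 * (P2 * (P3 * Z)) = mat_adjoint X * (A * (X * Z))" if "dim_row Z = n" for Z
    using arg_cong[OF eq, of "\<lambda>M. M * Z"] that by (simp add: mult_mat_assoc d)
  have eq': "P3 * (P2 * P1) = mat_adjoint X * (mat_adjoint A * X)"
  proof -
    have "mat_adjoint (P1 * P2 * P3) = P3 * (P2 * P1)"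
      using mat_adjoint_mult[OF mult_carrier_mat[OF c(1,2)] c(3)] mat_adjoint_mult[OF c(1,2)] h by simp
    moreover have "mat_adjoint (mat_adjoint X * A * X) = mat_adjoint X * (mat_adjoint A * X)"
      using mat_adjoint_mult[OF mult_carrier_mat[OF mat_adjoint_carrier[OF X] A] X]
        mat_adjoint_mult[OF mat_adjoint_carrier[OF X] A] by simp
    ultimately show ?thesis using eq by simp
  qed
  have eqZ': "P3 * (P2 * (P1 * Z)) = mat_adjoint X * (mat_adjoint A * (X * Z))" if "dim_row Z = n" for Z
    using arg_cong[OF eq', of "\<lambda>M. M * Z"] that by (simp add: mult_mat_assoc d)
  have AB': "mat_adjoint A * mat_adjoint B = 1\<^sub>m m"
    using mat_adjoint_mult[OF B(1) A] B(3) by simp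
  \<comment> \<open>preimages of \<open>X\<^sup>*\<close> under the outer factors\<close>
  define Y1 where "Y1 = P2 * (P3 * (mat_adjoint X * B))"
  define Y3 where "Y3 = P2 * (P1 * (mat_adjoint X * mat_adjoint B))"
  have Y: "Y1 \<in> carrier_mat n m" "Y3 \<in> carrier_mat n m"
    unfolding Y1_def Y3_def by (rule carrier_matI; simp add: d)+
  note d = d carrier_matD[OF Y(1)] carrier_matD[OF Y(2)]
  have PY1: "P1 * Y1 = mat_adjoint X"
    unfolding Y1_def using X by (simp add: eqZ XXZ d B(2))
  have PY3: "P3 * Y3 = mat_adjoint X"
    unfolding Y3_def using X by (simp add: eqZ' XXZ d AB')
  let ?S1 = "mat_adjoint Y1 * P1 * Y1" and ?S3 = "mat_adjoint Y3 * P3 * Y3" and ?M = "X * P2 * mat_adjoint X"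
  have S1: "pos_def_mat m ?S1" using pos_def_congruence[OF P(1) Y(1) X] PY1 XX by simp
  have S3: "pos_def_mat m ?S3" using pos_def_congruence[OF P(3) Y(2) X] PY3 XX by simp
  have aY1: "mat_adjoint Y1 * P1 = X"
    using mat_adjoint_mult[OF c(1) Y(1)] PY1 h by simp
  have aY3: "mat_adjoint Y3 * P3 = X"
    using mat_adjoint_mult[OF c(3) Y(2)] PY3 h by simp
  have "?S1 * A * ?S3 = mat_adjoint Y1 * (mat_adjoint X * (A * (X * Y3)))"
    unfolding aY3 by (simp add: mult_mat_assoc d PY1)
  also have "\<dots> = mat_adjoint Y1 * P1 * P2 * (P3 * Y3)"
    by (simp add: eqZ[symmetric] mult_mat_assoc d)
  also have "\<dots> = ?M" unfolding aY1 PY3 ..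
  finally have M_eq: "?S1 * A * ?S3 = ?M" .
  have Sc: "?S1 \<in> carrier_mat m m" "?S3 \<in> carrier_mat m m"
    using S1 S3 by (simp_all only: pos_def_mat_def)
  have "det ?M \<noteq> 0"
    unfolding M_eq[symmetric] using det_mult[OF Sc(1) A] det_mult[OF mult_carrier_mat[OF Sc(1) A] Sc(2)]
      pos_def_det_nz[OF S1] pos_def_det_nz[OF S3] dA by simp
  moreover have "pos_semidef_mat m ?M"
    using pos_semidef_congruence[OF P(2) mat_adjoint_carrier[OF X]] by simp
  ultimately have M: "pos_def_mat m ?M" using pos_def_if_pos_semidef_det_nz by blast
  obtain Z1 where Z1: "Z1 \<in> carrier_mat m m" "?S1 * Z1 = 1\<^sub>m m" "Z1 * ?S1 = 1\<^sub>m m"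
    using obtain_inverse_mat[OF Sc(1) pos_def_det_nz[OF S1]] by metis
  obtain Z3 where Z3: "Z3 \<in> carrier_mat m m" "?S3 * Z3 = 1\<^sub>m m"
    using obtain_inverse_mat[OF Sc(2) pos_def_det_nz[OF S3]] by metis
  have "Z1 * ?M * Z3 = (Z1 * ?S1) * A * (?S3 * Z3)"
    unfolding M_eq[symmetric] using Z1(1) Z3(1) by (simp add: mult_mat_assoc d)
  also have "\<dots> = A" unfolding Z1(3) Z3(2) using A by simp
  finally have "A = Z1 * ?M * Z3" ..
  moreover have "pos_def_mat m Z1" "pos_def_mat m Z3"
    using pos_def_inverse[OF pos_semidef_if_pos_def[OF S1] Z1(1,2)]
      pos_def_inverse[OF pos_semidef_if_pos_def[OF S3] Z3] .
  ultimately show "product_of_three (pos_def_mat m) A"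
    unfolding product_of_three_def using M by blast
qed


section \<open>Congruence to a diagonalizable matrix\<close>

text \<open>
  Some \<open>S\<^sup>* T S\<close> equals \<open>Q D Q\<^sup>-\<^sup>1\<close> with a real diagonal matrix \<open>D\<close>. The strict bound \<open>b\<close> on the
  eigenvalues leaves room for adjoining a further eigenvalue that is different from all of them.
\<close>

definition congruent_to_diagonalizable :: "nat \<Rightarrow> real \<Rightarrow> complex mat \<Rightarrow> bool" where
  "congruent_to_diagonalizable n b T \<longleftrightarrow>
     (\<exists>S Q d. S \<in> carrier_mat n n \<and> Q \<in> carrier_mat n n \<and> det S \<noteq> 0 \<and> det Q \<noteq> 0 \<and>
        (\<forall>i<n. 0 \<le> d i \<and> d i < b) \<and>
        mat_adjoint S * T * S * Q = Q * mat_diag n (\<lambda>i. complex_of_real (d i)))"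

text \<open>
  With \<open>V = Q\<^sup>-\<^sup>1 S\<^sup>-\<^sup>1\<close> and \<open>W = Q\<^sup>* S\<^sup>*\<close>, the factors are \<open>(S\<^sup>-\<^sup>1)\<^sup>* S\<^sup>-\<^sup>1\<close>, \<open>W\<^sup>* D W\<close> and \<open>V\<^sup>* V\<close>; note that
  \<open>W V\<^sup>* = I\<close>.
\<close>

lemma product_of_three_if_congruent_to_diagonalizable:
  assumes T: "T \<in> carrier_mat n n" and C: "congruent_to_diagonalizable n b T"
  shows "product_of_three (pos_semidef_mat n) T"
proof -
  obtain S Q d where S: "S \<in> carrier_mat n n" "det S \<noteq> 0" and Q: "Q \<in> carrier_mat n n" "det Q \<noteq> 0"
    and d: "\<And>i. i < n \<Longrightarrow> 0 \<le> d i"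
    and eq: "mat_adjoint S * T * S * Q = Q * mat_diag n (\<lambda>i. complex_of_real (d i))"
    using C unfolding congruent_to_diagonalizable_def by blast
  obtain S' where S': "S' \<in> carrier_mat n n" "S * S' = 1\<^sub>m n" "S' * S = 1\<^sub>m n"
    using obtain_inverse_mat[OF S] by metis
  obtain Q' where Q': "Q' \<in> carrier_mat n n" "Q * Q' = 1\<^sub>m n" "Q' * Q = 1\<^sub>m n"
    using obtain_inverse_mat[OF Q] by metis
  define D where "D = mat_diag n (\<lambda>i. complex_of_real (d i))"
  have D: "D \<in> carrier_mat n n" by (simp add: D_def)
  note dims = carrier_matD[OF S(1)] carrier_matD[OF S'(1)] carrier_matD[OF Q(1)] carrier_matD[OF Q'(1)]
    carrier_matD[OF T] carrier_matD[OF D]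
  define W where "W = mat_adjoint Q * mat_adjoint S"
  define V where "V = Q' * S'"
  have W: "W \<in> carrier_mat n n" and V: "V \<in> carrier_mat n n"
    unfolding W_def V_def by (intro mult_carrier_mat[of _ n n] mat_adjoint_carrier S Q S' Q')+
  have aW: "mat_adjoint W = S * Q"
    unfolding W_def using mat_adjoint_mult[OF mat_adjoint_carrier[OF Q(1)] mat_adjoint_carrier[OF S(1)]] by simp
  have aV: "mat_adjoint V = mat_adjoint S' * mat_adjoint Q'"
    unfolding V_def using mat_adjoint_mult[OF Q'(1) S'(1)] .
  have SS: "mat_adjoint S' * mat_adjoint S = 1\<^sub>m n" "mat_adjoint S * mat_adjoint S' = 1\<^sub>m n"
    using mat_adjoint_mult[OF S(1) S'(1), unfolded S'(2)] mat_adjoint_mult[OF S'(1) S(1), unfolded S'(3)]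
    by (metis mat_adjoint_one)+
  have QQ: "mat_adjoint Q * mat_adjoint Q' = 1\<^sub>m n"
    using mat_adjoint_mult[OF Q'(1) Q(1)] Q' by simp
  note cancel = mult_cancel_inverse[OF S'(3)] mult_cancel_inverse[OF S'(2)] mult_cancel_inverse[OF Q'(2)]
    mult_cancel_inverse[OF SS(1)] mult_cancel_inverse[OF SS(2)] mult_cancel_inverse[OF QQ]
  have eqZ: "Q * (D * Z) = mat_adjoint S * (T * (S * (Q * Z)))" if "dim_row Z = n" for Z
    using arg_cong[OF eq, of "\<lambda>M. M * Z"] that by (simp add: mult_mat_assoc dims D_def[symmetric])
  have "(mat_adjoint S' * S') * (mat_adjoint W * D * W) * (mat_adjoint V * V) =
      mat_adjoint S' * (Q * (D * (Q' * S')))"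
    unfolding aW aV unfolding W_def V_def by (simp add: mult_mat_assoc dims cancel)
  also have "\<dots> = T"
    using T by (simp add: eqZ dims cancel S'(2))
  finally have "T = (mat_adjoint S' * S') * (mat_adjoint W * D * W) * (mat_adjoint V * V)" ..
  moreover have "pos_semidef_mat n (mat_adjoint W * D * W)"
    using pos_semidef_congruence[OF pos_semidef_diag W] d unfolding D_def by blast
  ultimately show ?thesis
    unfolding product_of_three_def using pos_semidef_gram[OF S'(1)] pos_semidef_gram[OF V] by blast
qed

lemma congruent_to_diagonalizable_congruence:
  assumes T: "T \<in> carrier_mat n n" and U: "U \<in> carrier_mat n n" "det U \<noteq> 0"
    and C: "congruent_to_diagonalizable n b (mat_adjoint U * T * U)"
  shows "congruent_to_diagonalizable n b T"
proof -
  obtain S Q d where S: "S \<in> carrier_mat n n" "det S \<noteq> 0" and Q: "Q \<in> carrier_mat n n" "det Q \<noteq> 0"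
    and d: "\<forall>i<n. 0 \<le> d i \<and> d i < b"
    and eq: "mat_adjoint S * (mat_adjoint U * T * U) * S * Q = Q * mat_diag n (\<lambda>i. complex_of_real (d i))"
    using C unfolding congruent_to_diagonalizable_def by blast
  note dims = carrier_matD[OF S(1)] carrier_matD[OF U(1)] carrier_matD[OF Q(1)] carrier_matD[OF T]
  have "mat_adjoint (U * S) * T * (U * S) * Q = mat_adjoint S * (mat_adjoint U * T * U) * S * Q"
    by (simp add: mat_adjoint_mult[OF U(1) S(1)] mult_mat_assoc dims)
  moreover have "det (U * S) \<noteq> 0" using det_mult[OF U(1) S(1)] U S by simp
  moreover have "U * S \<in> carrier_mat n n" using U S by simp
  ultimately show ?thesis
    unfolding congruent_to_diagonalizable_def using Q d eq by metis
qed

lemma congruent_to_diagonalizable_zero: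
  assumes "0 < b"
  shows "congruent_to_diagonalizable n b (0\<^sub>m n n)"
proof -
  have "mat_diag n (\<lambda>i. complex_of_real 0) = 0\<^sub>m n n" by (intro eq_matI) (auto simp: mat_diag_def)
  then show ?thesis
    unfolding congruent_to_diagonalizable_def using assms
    by (intro exI[of _ "1\<^sub>m n"] exI[of _ "\<lambda>_. 0"]) auto
qed

lemma mult_lower_block_triangular:
  fixes A :: "'a :: semiring_1 mat"
  assumes "A \<in> carrier_mat p p" "C \<in> carrier_mat q p" "D \<in> carrier_mat q q"
    and "A' \<in> carrier_mat p p" "C' \<in> carrier_mat q p" "D' \<in> carrier_mat q q"
  shows "four_block_mat A (0\<^sub>m p q) C D * four_block_mat A' (0\<^sub>m p q) C' D' =
    four_block_mat (A * A') (0\<^sub>m p q) (C * A' + D * C') (D * D')"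
proof -
  have "A * A' + 0\<^sub>m p q * C' = A * A'" "A * 0\<^sub>m p q + 0\<^sub>m p q * D' = 0\<^sub>m p q"
    "C * 0\<^sub>m p q + D * D' = D * D'"
    using assms by auto
  then show ?thesis using mult_four_block_mat[OF assms(1) zero_carrier_mat assms(2,3,4) zero_carrier_mat assms(5,6)] by simp
qed

text \<open>
  After a congruence of the corner, the matrix has the form \<open>[a 0; c' K]\<close> with \<open>K Q = Q D\<close>. The vector
  with first entry 1 and remaining part \<open>z\<close> is an eigenvector for \<open>a\<close> if \<open>c' + K z = a z\<close>. In the
  eigenbasis \<open>Q\<close> of \<open>K\<close> this is a diagonal system, which is solvable because \<open>a\<close> exceeds all
  entries of \<open>D\<close>.
\<close>

lemma congruent_to_diagonalizable_block:
  assumes N: "N \<in> carrier_mat n n" and c: "c \<in> carrier_mat n 1"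
    and C: "congruent_to_diagonalizable n a N" and a: "0 \<le> a" "a < b"
  shows "congruent_to_diagonalizable (1 + n) b (four_block_mat (complex_of_real a \<cdot>\<^sub>m 1\<^sub>m 1) (0\<^sub>m 1 n) c N)"
    (is "congruent_to_diagonalizable _ b ?F")
proof -
  obtain S Q d where S: "S \<in> carrier_mat n n" "det S \<noteq> 0" and Q: "Q \<in> carrier_mat n n" "det Q \<noteq> 0"
    and d: "\<forall>i<n. 0 \<le> d i \<and> d i < a"
    and eq: "mat_adjoint S * N * S * Q = Q * mat_diag n (\<lambda>i. complex_of_real (d i))"
    using C unfolding congruent_to_diagonalizable_def by blast
  obtain Q' where Q': "Q' \<in> carrier_mat n n" "Q * Q' = 1\<^sub>m n"
    using obtain_inverse_mat[OF Q] by metis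
  define D where "D = mat_diag n (\<lambda>i. complex_of_real (d i))"
  have D: "D \<in> carrier_mat n n" by (simp add: D_def)
  \<comment> \<open>\<open>w\<close> and \<open>y\<close> are the coordinates of the off-diagonal block and of \<open>z\<close> with respect to \<open>Q\<close>\<close>
  define w where "w = Q' * (mat_adjoint S * c)"
  have w: "w \<in> carrier_mat n 1"
    unfolding w_def by (intro mult_carrier_mat[of _ n n] mat_adjoint_carrier Q' S c)
  define y where "y = mat n 1 (\<lambda>(i, j). w $$ (i, j) / of_real (a - d i))"
  have y: "y \<in> carrier_mat n 1" by (simp add: y_def)
  have "w + D * y = complex_of_real a \<cdot>\<^sub>m y"
  proof (rule eq_matI)
    fix i j assume "i < dim_row (complex_of_real a \<cdot>\<^sub>m y)" "j < dim_col (complex_of_real a \<cdot>\<^sub>m y)"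
    then have ij: "i < n" "j < 1" using y by auto
    define u where "u = w $$ (i, j) / complex_of_real (a - d i)"
    have "complex_of_real (a - d i) \<noteq> 0" using d ij by force
    then have "w $$ (i, j) = complex_of_real (a - d i) * u" by (simp add: u_def)
    moreover have "y $$ (i, j) = u" using ij by (simp add: y_def u_def)
    moreover have "(D * y) $$ (i, j) = of_real (d i) * y $$ (i, j)"
      unfolding D_def mat_diag_mult_left[OF y] using ij by simp
    ultimately show "(w + D * y) $$ (i, j) = (complex_of_real a \<cdot>\<^sub>m y) $$ (i, j)"
      using ij w D y by (simp add: algebra_simps)
  qed (use w D y in auto)
  define z where "z = Q * y"
  have z: "z \<in> carrier_mat n 1" using Q y by (simp add: z_def)
  define K where "K = mat_adjoint S * N * S"
  have K: "K \<in> carrier_mat n n"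
    unfolding K_def by (intro mult_carrier_mat[of _ n n] mat_adjoint_carrier S N)
  have Sc: "mat_adjoint S * c \<in> carrier_mat n 1" by (intro mult_carrier_mat[of _ n n] mat_adjoint_carrier S c)
  have "Q * w = mat_adjoint S * c"
    unfolding w_def using mult_cancel_inverse[OF Q'(2)] Q(1) Q'(1) S(1) by simp
  moreover have "K * z = Q * (D * y)"
    using arg_cong[OF eq, of "\<lambda>M. M * y"] K Q(1) D y unfolding K_def[symmetric] D_def[symmetric] z_def
    by (simp add: assoc_mult_mat[of _ n n _ n _ 1])
  ultimately have "mat_adjoint S * c + K * z = Q * (w + D * y)"
    using mult_add_distrib_mat[OF Q(1) w mult_carrier_mat[OF D y]] by simp
  also have "\<dots> = complex_of_real a \<cdot>\<^sub>m z"
    unfolding \<open>w + D * y = _\<close> z_def using mult_smult_distrib[OF Q(1) y] .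
  finally have z_eq: "mat_adjoint S * c + K * z = complex_of_real a \<cdot>\<^sub>m z" .
  let ?a = "complex_of_real a \<cdot>\<^sub>m 1\<^sub>m 1 :: complex mat"
  let ?S = "four_block_mat (1\<^sub>m 1) (0\<^sub>m 1 n) (0\<^sub>m n 1) S"
  let ?Q = "four_block_mat (1\<^sub>m 1) (0\<^sub>m 1 n) z Q"
  let ?d = "\<lambda>i. if i = 0 then a else d (i - 1)"
  have ac: "?a \<in> carrier_mat 1 1" by simp
  have "mat_adjoint ?S = four_block_mat (1\<^sub>m 1) (0\<^sub>m 1 n) (0\<^sub>m n 1) (mat_adjoint S)"
    using S(1) by (subst mat_adjoint_four_block[of _ 1 1 _ n _ n]) auto
  moreover have aS: "mat_adjoint S \<in> carrier_mat n n" "mat_adjoint S * N \<in> carrier_mat n n"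
    by (intro mult_carrier_mat[of _ n n] mat_adjoint_carrier S N)+
  moreover have "?a * 1\<^sub>m 1 = ?a" "1\<^sub>m 1 * ?a = ?a" by simp_all
  ultimately have "mat_adjoint ?S * ?F = four_block_mat ?a (0\<^sub>m 1 n) (mat_adjoint S * c) (mat_adjoint S * N)"
    using mult_lower_block_triangular[OF one_carrier_mat[of 1] zero_carrier_mat aS(1) ac c N] Sc by simp
  moreover have "four_block_mat ?a (0\<^sub>m 1 n) (mat_adjoint S * c) (mat_adjoint S * N) * ?S =
      four_block_mat ?a (0\<^sub>m 1 n) (mat_adjoint S * c) K"
    using mult_lower_block_triangular[OF ac Sc aS(2) one_carrier_mat zero_carrier_mat S(1)]
      \<open>?a * 1\<^sub>m 1 = ?a\<close> right_mult_one_mat[OF Sc] right_mult_zero_mat[OF aS(2), of 1]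
      right_add_zero_mat[OF Sc] unfolding K_def by simp
  moreover have "four_block_mat ?a (0\<^sub>m 1 n) (mat_adjoint S * c) K * ?Q =
      four_block_mat ?a (0\<^sub>m 1 n) (mat_adjoint S * c + K * z) (K * Q)"
    using mult_lower_block_triangular[OF ac Sc K one_carrier_mat z Q(1)] \<open>?a * 1\<^sub>m 1 = ?a\<close> right_mult_one_mat[OF Sc] by simp
  ultimately have "mat_adjoint ?S * ?F * ?S * ?Q = four_block_mat ?a (0\<^sub>m 1 n) (mat_adjoint S * c + K * z) (K * Q)"
    by simp
  also have "\<dots> = four_block_mat ?a (0\<^sub>m 1 n) (complex_of_real a \<cdot>\<^sub>m z) (Q * D)"
    unfolding z_eq using eq by (simp add: K_def D_def)
  also have "\<dots> = ?Q * four_block_mat ?a (0\<^sub>m 1 n) (0\<^sub>m n 1) D"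
  proof -
    have "z * ?a = complex_of_real a \<cdot>\<^sub>m z" "Q * 0\<^sub>m n 1 = 0\<^sub>m n 1" "1\<^sub>m 1 * ?a = ?a"
      using mult_smult_distrib[OF z one_carrier_mat[of 1], of "complex_of_real a"] right_mult_one_mat[OF z] Q(1) by simp_all
    moreover have "complex_of_real a \<cdot>\<^sub>m z + 0\<^sub>m n 1 = complex_of_real a \<cdot>\<^sub>m z" using z by simp
    ultimately show ?thesis
      using mult_lower_block_triangular[OF one_carrier_mat z Q(1) ac zero_carrier_mat D] by simp
  qed
  also have "four_block_mat ?a (0\<^sub>m 1 n) (0\<^sub>m n 1) D = mat_diag (1 + n) (\<lambda>i. complex_of_real (?d i))"
    by (intro eq_matI) (auto simp: mat_diag_def D_def)
  finally have "mat_adjoint ?S * ?F * ?S * ?Q = ?Q * mat_diag (1 + n) (\<lambda>i. complex_of_real (?d i))" .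
  moreover have "det ?S \<noteq> 0"
    using S by (subst det_four_block_mat_upper_right_zero[of _ 1 _ n]) auto
  moreover have "det ?Q \<noteq> 0"
    using Q z by (subst det_four_block_mat_upper_right_zero[of _ 1 _ n]) auto
  moreover have "?S \<in> carrier_mat (1 + n) (1 + n)" "?Q \<in> carrier_mat (1 + n) (1 + n)"
    using S(1) Q(1) by (intro four_block_carrier_mat; simp)+
  moreover have "\<forall>i<1 + n. 0 \<le> ?d i \<and> ?d i < b" 
  proof (intro allI impI)
    fix i assume "i < 1 + n"
    then show "0 \<le> ?d i \<and> ?d i < b" using d[rule_format, of "i - 1"] a by (cases i) auto
  qed
  ultimately show ?thesis
    unfolding congruent_to_diagonalizable_def
    by (intro exI[of _ ?S] exI[of _ ?Q] exI[of _ ?d] conjI)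
qed


section \<open>Kernel vectors that the adjoint does not annihilate\<close>

text \<open>
  For any \<open>w\<close> with \<open>g\<^sup>* w \<noteq> 0\<close>, adding a multiple of \<open>k\<close> to \<open>w\<close> adjusts the value of the form to \<open>a\<close>,
  and changes \<open>T\<^sup>* w\<close> only by a multiple of \<open>g\<close>. The implication in the conclusion is what keeps the
  induction below going: \<open>T\<^sup>* s\<close> can be chosen outside the line spanned by \<open>g\<close> unless that line
  contains the whole range of \<open>T\<^sup>*\<close>. Such a choice of \<open>w\<close> exists because a vector space is not the
  union of the two proper subspaces \<open>{w. g\<^sup>* w = 0}\<close> and \<open>{w. T\<^sup>* w \<in> span g}\<close>.
\<close>

lemma exists_vector_prescribed_form:
  fixes T :: "complex mat"
  assumes T: "T \<in> carrier_mat n n" and k: "k \<in> carrier_vec n" and Tk: "T *\<^sub>v k = 0\<^sub>v n"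
    and g: "g = mat_adjoint T *\<^sub>v k" and g0: "g \<noteq> 0\<^sub>v n"
  obtains s where "s \<in> carrier_vec n" "(T *\<^sub>v s) \<bullet>c s = a"
    "(\<exists>\<mu>. mat_adjoint T *\<^sub>v s = \<mu> \<cdot>\<^sub>v g) \<longrightarrow> (\<forall>v\<in>carrier_vec n. \<exists>\<mu>. mat_adjoint T *\<^sub>v v = \<mu> \<cdot>\<^sub>v g)"
proof -
  let ?T = "mat_adjoint T"
  let ?in = "\<lambda>v. \<exists>\<mu>. ?T *\<^sub>v v = \<mu> \<cdot>\<^sub>v g"
  have Tc: "?T \<in> carrier_mat n n" using T by simp
  have gc: "g \<in> carrier_vec n" unfolding g using Tc k by simp
  have gg: "g \<bullet>c g \<noteq> 0" using gc g0 by simp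
  have "\<exists>w\<in>carrier_vec n. w \<bullet>c g \<noteq> 0 \<and> (?in w \<longrightarrow> (\<forall>v\<in>carrier_vec n. ?in v))"
  proof (cases "\<forall>v\<in>carrier_vec n. ?in v")
    case True
    then show ?thesis using gc gg by blast
  next
    case False
    then obtain w0 where w0: "w0 \<in> carrier_vec n" "\<not> ?in w0" by blast
    consider "\<not> ?in g" | "w0 \<bullet>c g \<noteq> 0" | \<mu> where "?T *\<^sub>v g = \<mu> \<cdot>\<^sub>v g" "w0 \<bullet>c g = 0" by blast
    then show ?thesis
    proof cases
      case 1
      then show ?thesis using gc gg by blast
    next
      case 2
      then show ?thesis using w0 by blast
    next
      case 3
      have "\<not> ?in (w0 + g)"
      proof
        assume "?in (w0 + g)"
        then obtain \<nu> where "?T *\<^sub>v (w0 + g) = \<nu> \<cdot>\<^sub>v g" by blast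
        then have nu: "?T *\<^sub>v w0 + \<mu> \<cdot>\<^sub>v g = \<nu> \<cdot>\<^sub>v g"
          using mult_add_distrib_mat_vec[OF Tc w0(1) gc] 3(1) by simp
        have "?T *\<^sub>v w0 = (\<nu> - \<mu>) \<cdot>\<^sub>v g"
        proof (rule eq_vecI)
          fix i assume "i < dim_vec ((\<nu> - \<mu>) \<cdot>\<^sub>v g)"
          then have i: "i < n" using gc by simp
          from arg_cong[OF nu, of "\<lambda>v. v $ i"] have "(?T *\<^sub>v w0) $ i + \<mu> * g $ i = \<nu> * g $ i"
            using i Tc gc by simp
          then show "(?T *\<^sub>v w0) $ i = ((\<nu> - \<mu>) \<cdot>\<^sub>v g) $ i" using i gc by (simp add: algebra_simps)
        qed (use Tc gc in auto)
        with w0(2) show False by blast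
      qed
      moreover have "(w0 + g) \<bullet>c g \<noteq> 0"
        using add_scalar_prod_distrib[OF w0(1) gc carrier_vec_conjugate[OF gc]] 3(2) gg by simp
      ultimately show ?thesis using add_carrier_vec[OF w0(1) gc] by blast
    qed
  qed
  then obtain w where w1: "w \<in> carrier_vec n" and w2: "w \<bullet>c g \<noteq> 0 \<and> (?in w \<longrightarrow> (\<forall>v\<in>carrier_vec n. ?in v))"
    by (rule bexE)
  note w = w1 conjunct1[OF w2]
  \<comment> \<open>conjugated, since the second argument of the form is the antilinear one\<close>
  define \<kappa> where "\<kappa> = cnj ((a - (T *\<^sub>v w) \<bullet>c w) / (w \<bullet>c g))"
  define s where "s = w + \<kappa> \<cdot>\<^sub>v k"
  have lk: "\<kappa> \<cdot>\<^sub>v k \<in> carrier_vec n" using k by simp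
  have s: "s \<in> carrier_vec n" using w k by (simp add: s_def)
  have "T *\<^sub>v s = T *\<^sub>v w + \<kappa> \<cdot>\<^sub>v (T *\<^sub>v k)"
    unfolding s_def using mult_add_distrib_mat_vec[OF T w(1) lk] mult_mat_vec[OF T k] by simp
  also have "\<dots> = T *\<^sub>v w" unfolding Tk using T w(1) by (intro eq_vecI) auto
  finally have Ts: "T *\<^sub>v s = T *\<^sub>v w" .
  have Tw: "T *\<^sub>v w \<in> carrier_vec n" using T w(1) by simp
  have cs: "conjugate s = conjugate w + cnj \<kappa> \<cdot>\<^sub>v conjugate k"
    unfolding s_def using w(1) k by (intro eq_vecI) auto
  have "(T *\<^sub>v s) \<bullet>c s = (T *\<^sub>v w) \<bullet>c w + cnj \<kappa> * ((T *\<^sub>v w) \<bullet>c k)"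
    unfolding Ts cs using w(1) k Tw by (subst scalar_prod_add_distrib[of _ n]) auto
  also have "(T *\<^sub>v w) \<bullet>c k = w \<bullet>c g"
    using mat_adjoint_scalar_prod[OF T w(1) k] g by simp
  also have "(T *\<^sub>v w) \<bullet>c w + cnj \<kappa> * (w \<bullet>c g) = a"
    using w(2) by (simp add: \<kappa>_def)
  finally have form: "(T *\<^sub>v s) \<bullet>c s = a" .
  have Tas: "?T *\<^sub>v s = ?T *\<^sub>v w + \<kappa> \<cdot>\<^sub>v g"
    unfolding s_def g using mult_add_distrib_mat_vec[OF Tc w(1) lk] mult_mat_vec[OF Tc k] by simp
  have in_w: "?in w" if "?in s"
  proof -
    from that obtain \<mu> where mu: "?T *\<^sub>v w + \<kappa> \<cdot>\<^sub>v g = \<mu> \<cdot>\<^sub>v g" using Tas by auto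
    have "?T *\<^sub>v w = (\<mu> - \<kappa>) \<cdot>\<^sub>v g"
    proof (rule eq_vecI)
      fix i assume "i < dim_vec ((\<mu> - \<kappa>) \<cdot>\<^sub>v g)"
      then have i: "i < n" using gc by simp
      from arg_cong[OF mu, of "\<lambda>v. v $ i"] have "(?T *\<^sub>v w) $ i + \<kappa> * g $ i = \<mu> * g $ i"
        using i Tc gc by simp
      then show "(?T *\<^sub>v w) $ i = ((\<mu> - \<kappa>) \<cdot>\<^sub>v g) $ i" using i gc by (simp add: algebra_simps)
    qed (use Tc gc in auto)
    then show ?thesis by blast
  qed
  show ?thesis
    by (rule that[OF s form]) (rule impI, rule mp[OF conjunct2[OF w2]], rule in_w)
qed

text \<open>
  Extend \<open>g\<close> to an orthogonal basis and exchange \<open>g\<close> for \<open>s\<close>. The product of the adjoint of the old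
  basis matrix with the new one is lower triangular with nonzero diagonal, so the new one is invertible.
\<close>

lemma exists_basis_orthogonal_to_vector:
  fixes s g :: "complex vec"
  assumes s: "s \<in> carrier_vec n" and g: "g \<in> carrier_vec n" and sg: "s \<bullet>c g \<noteq> 0"
  obtains S where "S \<in> carrier_mat n n" "det S \<noteq> 0" "col S 0 = s"
    "\<forall>j\<in>{1..<n}. col S j \<bullet>c g = 0"
proof -
  interpret cof_vec_space n "TYPE(complex)" .
  have g0: "g \<noteq> 0\<^sub>v n" using sg s by auto
  then have n: "0 < n" using g by (cases n) auto
  note b = basis_completion[OF g g0]
  define ws where "ws = gram_schmidt n (basis_completion g)"
  note gs = gram_schmidt_result[OF b(2,4,5) ws_def]
  have len: "length ws = n" using gs(4) b(6) by simp
  have hd: "ws ! 0 = g"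
  proof -
    obtain vs where "basis_completion g = g # vs" by (auto simp: basis_completion_def Let_def)
    then have "hd ws = g" unfolding ws_def using g by simp
    then show ?thesis using n len by (metis hd_conv_nth length_0_conv less_numeral_extra(3))
  qed
  have wc: "ws ! i \<in> carrier_vec n" if "i < n" for i using gs(3) len that by (metis nth_mem subsetD)
  have orth: "ws ! i \<bullet>c ws ! j = 0 \<longleftrightarrow> i \<noteq> j" if "i < n" "j < n" for i j
    using corthogonalD[OF gs(2)] that len by simp
  define W where "W = mat_of_cols n ws"
  define S where "S = mat_of_cols n (ws[0 := s])"
  have W: "W \<in> carrier_mat n n" and S: "S \<in> carrier_mat n n"
    by (rule carrier_matI; simp add: W_def S_def len)+
  have cW: "col W j = ws ! j" if "j < n" for j unfolding W_def using that wc len by simp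
  have cS: "col S j = (if j = 0 then s else ws ! j)" if "j < n" for j
    unfolding S_def using that wc len s by simp
  have E: "(mat_adjoint W * S) $$ (i, j) = col S j \<bullet>c ws ! i" if "i < n" "j < n" for i j
  proof -
    have "row (mat_adjoint W) i = conjugate (ws ! i)"
      using that W cW[of i] wc[of i] by (intro eq_vecI) (auto simp flip: cW)
    then show ?thesis using that W S wc[of i] by (simp add: comm_scalar_prod[of _ n])
  qed
  have WS: "mat_adjoint W * S \<in> carrier_mat n n" by (intro mult_carrier_mat[of _ n n] mat_adjoint_carrier W S)
  have "det (mat_adjoint W * S) = prod_list (diag_mat (mat_adjoint W * S))"
  proof (rule det_lower_triangular[OF _ WS])
    fix i j assume "i < j" "j < n"
    then show "(mat_adjoint W * S) $$ (i, j) = 0" using E[of i j] cS orth[of j i] by simp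
  qed
  also have "\<dots> \<noteq> 0"
  proof -
    have "(mat_adjoint W * S) $$ (i, i) \<noteq> 0" if "i < n" for i
      using that E[of i i] cS[of i] orth[of i i] hd sg by (cases "i = 0") auto
    then show ?thesis using WS unfolding prod_list_zero_iff by (auto simp: diag_mat_def)
  qed
  finally have "det S \<noteq> 0" using det_mult[OF mat_adjoint_carrier[OF W] S] by auto
  moreover have "col S 0 = s" using cS n by simp
  moreover have "\<forall>j\<in>{1..<n}. col S j \<bullet>c g = 0"
  proof
    fix j assume "j \<in> {1..<n}"
    then show "col S j \<bullet>c g = 0" using cS[of j] orth[of j 0] hd n by simp
  qed
  ultimately show ?thesis by (rule that[OF S])
qed

lemma congruence_index:
  fixes T :: "complex mat"
  assumes T: "T \<in> carrier_mat n n" and S: "S \<in> carrier_mat n n" and "i < n" "j < n"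
  shows "(mat_adjoint S * T * S) $$ (i, j) = (T *\<^sub>v col S j) \<bullet>c col S i"
proof -
  have Sj: "col S j \<in> carrier_vec n" "col S i \<in> carrier_vec n" using S by auto
  have r: "row (mat_adjoint S) i = conjugate (col S i)"
    using assms by (intro eq_vecI) auto
  have "mat_adjoint S * T * S = mat_adjoint S * (T * S)" using S T by (intro mult_mat_assoc) auto
  then have "(mat_adjoint S * T * S) $$ (i, j) = row (mat_adjoint S) i \<bullet> col (T * S) j"
    using assms by simp
  also have "col (T * S) j = T *\<^sub>v col S j" using col_mult2[OF T S] assms by simp
  finally show ?thesis unfolding r using T Sj by (subst comm_scalar_prod[of _ n]) auto
qed


text \<open>
  The induction step passes from \<open>T\<close> to the corner \<open>N\<close> of \<open>A = S\<^sup>* T S = [a 0; c N]\<close>. In the new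
  coordinates \<open>k\<close> becomes \<open>k0\<close>, and \<open>A k0 = 0\<close> forces the first entry of \<open>k0\<close> to be 0, so its
  remaining part \<open>k'\<close> lies in the kernel of \<open>N\<close>. If \<open>N\<^sup>* k' = 0\<close>, then \<open>A\<^sup>* k0\<close> is a multiple of the
  first unit vector, and so is \<open>A\<^sup>*\<close> applied to that unit vector; that is, \<open>T\<^sup>* s\<close> and \<open>T\<^sup>* k\<close> are
  parallel. By the choice of \<open>s\<close> the range of \<open>T\<^sup>*\<close> is then a line, and hence \<open>N = 0\<close>.
\<close>

lemma congruent_to_diagonalizable_if_kernel_moved:
  fixes T :: "complex mat"
  assumes "T \<in> carrier_mat n n" "k \<in> carrier_vec n" "T *\<^sub>v k = 0\<^sub>v n"
    and "mat_adjoint T *\<^sub>v k \<noteq> 0\<^sub>v n" "0 < b"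
  shows "congruent_to_diagonalizable n b T"
  using assms
proof (induction n arbitrary: T k b)
  case 0
  have "mat_adjoint T *\<^sub>v k = 0\<^sub>v 0" using "0.prems"(1) by (intro eq_vecI) auto
  with "0.prems"(4) show ?case by contradiction
next
  case (Suc n)
  let ?N = "Suc n"
  note T = Suc.prems(1) and k = Suc.prems(2)
  define a where "a = b / 2"
  have a: "0 < a" "a < b" using Suc.prems(5) by (simp_all add: a_def)
  define g where "g = mat_adjoint T *\<^sub>v k"
  have Tc: "mat_adjoint T \<in> carrier_mat ?N ?N" using T by simp
  have g: "g \<in> carrier_vec ?N" unfolding g_def using Tc k by simp
  have g0: "g \<noteq> 0\<^sub>v ?N" using Suc.prems(4) g_def by simp
  obtain s where s: "s \<in> carrier_vec ?N" and form: "(T *\<^sub>v s) \<bullet>c s = complex_of_real a"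
    and par: "(\<exists>\<mu>. mat_adjoint T *\<^sub>v s = \<mu> \<cdot>\<^sub>v g) \<longrightarrow> (\<forall>v\<in>carrier_vec ?N. \<exists>\<mu>. mat_adjoint T *\<^sub>v v = \<mu> \<cdot>\<^sub>v g)"
    by (rule exists_vector_prescribed_form[OF T k Suc.prems(3) g_def g0, of "complex_of_real a"])
  define h where "h = mat_adjoint T *\<^sub>v s"
  have h: "h \<in> carrier_vec ?N" unfolding h_def using Tc s by simp
  have "s \<bullet>c h = complex_of_real a"
    unfolding h_def mat_adjoint_scalar_prod[OF T s s, symmetric] by (rule form)
  then have "s \<bullet>c h \<noteq> 0" using a by simp
  then obtain S where S: "S \<in> carrier_mat ?N ?N" "det S \<noteq> 0" and S0: "col S 0 = s"
    and Sj: "\<forall>j\<in>{1..<?N}. col S j \<bullet>c h = 0"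
    by (rule exists_basis_orthogonal_to_vector[OF s h])
  have Sa: "mat_adjoint S \<in> carrier_mat ?N ?N" using S by simp
  define A where "A = mat_adjoint S * T * S"
  have A: "A \<in> carrier_mat ?N ?N"
    unfolding A_def by (intro mult_carrier_mat[of _ ?N ?N] Sa T S)
  have A00: "A $$ (0, 0) = complex_of_real a"
    unfolding A_def using congruence_index[OF T S(1), of 0 0] S0 form by simp
  have A0j: "A $$ (0, j) = 0" if "0 < j" "j < ?N" for j
  proof -
    have "col S j \<in> carrier_vec ?N" using S that by simp
    from mat_adjoint_scalar_prod[OF T this s] show ?thesis
      unfolding A_def using congruence_index[OF T S(1), of 0 j] S0 that Sj by (simp add: h_def)
  qed
  let ?a = "complex_of_real a \<cdot>\<^sub>m 1\<^sub>m 1 :: complex mat"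
  define c where "c = mat n 1 (\<lambda>(i, j). A $$ (Suc i, 0))"
  define N where "N = mat n n (\<lambda>(i, j). A $$ (Suc i, Suc j))"
  have c: "c \<in> carrier_mat n 1" and N: "N \<in> carrier_mat n n" by (simp_all add: c_def N_def)
  have ac: "?a \<in> carrier_mat 1 1" by simp
  have AF: "A = four_block_mat ?a (0\<^sub>m 1 n) c N"
    using A A00 A0j by (intro eq_matI) (auto simp: c_def N_def)
  have cN: "mat_adjoint c \<in> carrier_mat 1 n" "mat_adjoint N \<in> carrier_mat n n" using c N by simp_all
  have aF: "mat_adjoint A = four_block_mat (mat_adjoint ?a) (mat_adjoint c) (0\<^sub>m n 1) (mat_adjoint N)"
    unfolding AF using mat_adjoint_four_block[OF ac zero_carrier_mat c N] by simp
  have adj_a: "mat_adjoint ?a = ?a" by (intro eq_matI) auto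
  have A_mult: "A *\<^sub>v v = mat_adjoint S *\<^sub>v (T *\<^sub>v (S *\<^sub>v v))" if "v \<in> carrier_vec ?N" for v
  proof -
    have "A *\<^sub>v v = (mat_adjoint S * T) *\<^sub>v (S *\<^sub>v v)"
      unfolding A_def by (rule assoc_mult_mat_vec[OF mult_carrier_mat[OF Sa T] S(1) that])
    also have "\<dots> = mat_adjoint S *\<^sub>v (T *\<^sub>v (S *\<^sub>v v))"
      by (rule assoc_mult_mat_vec[OF Sa T mult_mat_vec_carrier[OF S(1) that]])
    finally show ?thesis .
  qed
  have aA: "mat_adjoint A = mat_adjoint S * mat_adjoint T * S"
    unfolding A_def mat_adjoint_mult[OF mult_carrier_mat[OF Sa T] S(1)] mat_adjoint_mult[OF Sa T]
    using S(1) T by (simp add: mult_mat_assoc)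
  have aA_mult: "mat_adjoint A *\<^sub>v v = mat_adjoint S *\<^sub>v (mat_adjoint T *\<^sub>v (S *\<^sub>v v))" if "v \<in> carrier_vec ?N" for v
  proof -
    have "mat_adjoint A *\<^sub>v v = (mat_adjoint S * mat_adjoint T) *\<^sub>v (S *\<^sub>v v)"
      unfolding aA by (rule assoc_mult_mat_vec[OF mult_carrier_mat[OF Sa Tc] S(1) that])
    also have "\<dots> = mat_adjoint S *\<^sub>v (mat_adjoint T *\<^sub>v (S *\<^sub>v v))"
      by (rule assoc_mult_mat_vec[OF Sa Tc mult_mat_vec_carrier[OF S(1) that]])
    finally show ?thesis .
  qed
  obtain S' where S': "S' \<in> carrier_mat ?N ?N" "S * S' = 1\<^sub>m ?N"
    using obtain_inverse_mat[OF S] by metis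
  \<comment> \<open>the coordinates of \<open>k\<close> in the new basis\<close>
  define k0 where "k0 = S' *\<^sub>v k"
  have k0: "k0 \<in> carrier_vec ?N" unfolding k0_def using S' k by simp
  have Sk0: "S *\<^sub>v k0 = k"
    unfolding k0_def using assoc_mult_mat_vec[OF S(1) S'(1) k] S'(2) k by simp
  define x where "x = vec_first k0 1"
  define k' where "k' = vec_last k0 n"
  have x: "x \<in> carrier_vec 1" and k': "k' \<in> carrier_vec n" by (simp_all add: x_def k'_def)
  have split: "k0 = x @\<^sub>v k'" unfolding x_def k'_def using k0 by (subst vec_first_last_append) auto
  have S0v: "mat_adjoint S *\<^sub>v 0\<^sub>v ?N = 0\<^sub>v ?N" using mult_mat_zero_vec[OF Sa] .
  have zs: "0\<^sub>v ?N = 0\<^sub>v 1 @\<^sub>v (0\<^sub>v n :: complex vec)" by (intro eq_vecI) auto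
  have "A *\<^sub>v k0 = 0\<^sub>v ?N" using A_mult[OF k0] Sk0 Suc.prems(3) S0v by simp
  then have "(?a *\<^sub>v x + 0\<^sub>m 1 n *\<^sub>v k') @\<^sub>v (c *\<^sub>v x + N *\<^sub>v k') = 0\<^sub>v 1 @\<^sub>v 0\<^sub>v n"
    unfolding split AF zs four_block_mat_mult_vec[OF ac zero_carrier_mat c N x k'] .
  moreover have "?a *\<^sub>v x + 0\<^sub>m 1 n *\<^sub>v k' \<in> carrier_vec 1"
    by (intro add_carrier_vec mult_mat_vec_carrier[OF ac x] mult_mat_vec_carrier[OF zero_carrier_mat k'])
  ultimately have ker: "?a *\<^sub>v x + 0\<^sub>m 1 n *\<^sub>v k' = 0\<^sub>v 1" "c *\<^sub>v x + N *\<^sub>v k' = 0\<^sub>v n"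
    using append_vec_eq[OF _ zero_carrier_vec] by blast+
  have x0: "x = 0\<^sub>v 1"
  proof (rule eq_vecI)
    fix i assume "i < dim_vec (0\<^sub>v 1 :: complex vec)"
    then have i: "i = 0" by simp
    have "complex_of_real a * x $ 0 = 0"
      using arg_cong[OF ker(1), of "\<lambda>v. v $ 0"] x k' by (simp add: scalar_prod_def)
    then show "x $ i = 0\<^sub>v 1 $ i" using i a by simp
  qed (use x in auto)
  have "c *\<^sub>v x = 0\<^sub>v n" unfolding x0 using mult_mat_zero_vec[OF c] .
  then have Nk': "N *\<^sub>v k' = 0\<^sub>v n" using ker(2) N k' by simp
  have "congruent_to_diagonalizable n a N"
  proof (cases "mat_adjoint N *\<^sub>v k' = 0\<^sub>v n")
    case False
    then show ?thesis using Suc.IH[OF N k' Nk' False a(1)] by simp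
  next
    case True
    \<comment> \<open>the first row of \<open>A\<close> is supported in its first entry, so \<open>A\<^sup>*\<close> is block upper triangular\<close>
    have low: "\<exists>\<gamma>\<in>carrier_vec 1. mat_adjoint A *\<^sub>v (u @\<^sub>v v) = \<gamma> @\<^sub>v (mat_adjoint N *\<^sub>v v)"
      if "u \<in> carrier_vec 1" "v \<in> carrier_vec n" for u v
    proof -
      have "0\<^sub>m n 1 *\<^sub>v u = 0\<^sub>v n" using that by (intro eq_vecI) auto
      then have "mat_adjoint A *\<^sub>v (u @\<^sub>v v) = (?a *\<^sub>v u + mat_adjoint c *\<^sub>v v) @\<^sub>v (mat_adjoint N *\<^sub>v v)"
        unfolding aF adj_a four_block_mat_mult_vec[OF ac cN(1) zero_carrier_mat cN(2) that]
        using cN that by simp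
      moreover have "?a *\<^sub>v u + mat_adjoint c *\<^sub>v v \<in> carrier_vec 1"
        by (intro add_carrier_vec mult_mat_vec_carrier[OF ac that(1)] mult_mat_vec_carrier[OF cN(1) that(2)])
      ultimately show ?thesis by blast
    qed
    obtain \<gamma> where \<gamma>: "\<gamma> \<in> carrier_vec 1" and Sg: "mat_adjoint S *\<^sub>v g = \<gamma> @\<^sub>v 0\<^sub>v n"
      using low[OF x k'] True aA_mult[OF k0] Sk0 unfolding split[symmetric] g_def by auto
    have \<gamma>0: "\<gamma> $ 0 \<noteq> 0"
    proof
      assume "\<gamma> $ 0 = 0"
      then have "\<gamma> @\<^sub>v 0\<^sub>v n = 0\<^sub>v ?N" using \<gamma> by (intro eq_vecI) auto
      then have "g = 0\<^sub>v ?N"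
        using mult_mat_vec_inj[OF Sa det_mat_adjoint_nz[OF S] g zero_carrier_vec] Sg S0v by simp
      with g0 show False by contradiction
    qed
    define e where "e = (unit_vec ?N 0 :: complex vec)"
    have Se: "S *\<^sub>v e = s" unfolding e_def using S S0 by (intro eq_vecI) (auto simp: scalar_prod_right_unit)
    have e: "e = unit_vec 1 0 @\<^sub>v 0\<^sub>v n" unfolding e_def by (intro eq_vecI) auto
    have N0: "mat_adjoint N *\<^sub>v 0\<^sub>v n = 0\<^sub>v n" using mult_mat_zero_vec[OF cN(2)] .
    have ec: "e \<in> carrier_vec ?N" by (simp add: e_def)
    obtain \<delta> where \<delta>: "\<delta> \<in> carrier_vec 1" and Sh: "mat_adjoint S *\<^sub>v h = \<delta> @\<^sub>v 0\<^sub>v n"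
      using low[OF unit_vec_carrier[of 1 0] zero_carrier_vec] N0 aA_mult[OF ec] Se
      unfolding e[symmetric] h_def by auto
    have "mat_adjoint S *\<^sub>v h = (\<delta> $ 0 / \<gamma> $ 0) \<cdot>\<^sub>v (mat_adjoint S *\<^sub>v g)"
      unfolding Sh Sg using \<gamma> \<delta> \<gamma>0 by (intro eq_vecI) auto
    also have "\<dots> = mat_adjoint S *\<^sub>v ((\<delta> $ 0 / \<gamma> $ 0) \<cdot>\<^sub>v g)"
      using mult_mat_vec[OF Sa g] by simp
    finally have "h = (\<delta> $ 0 / \<gamma> $ 0) \<cdot>\<^sub>v g"
      using mult_mat_vec_inj[OF Sa det_mat_adjoint_nz[OF S] h, of "(\<delta> $ 0 / \<gamma> $ 0) \<cdot>\<^sub>v g"] g by simp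
    then have all: "\<forall>v\<in>carrier_vec ?N. \<exists>\<mu>. mat_adjoint T *\<^sub>v v = \<mu> \<cdot>\<^sub>v g"
      using par unfolding h_def by blast
    have "mat_adjoint N *\<^sub>v v = 0\<^sub>v n" if v: "v \<in> carrier_vec n" for v
    proof -
      have v': "0\<^sub>v 1 @\<^sub>v v \<in> carrier_vec ?N" using append_carrier_vec[OF zero_carrier_vec v, of 1] by simp
      then obtain \<mu> where mu: "mat_adjoint T *\<^sub>v (S *\<^sub>v (0\<^sub>v 1 @\<^sub>v v)) = \<mu> \<cdot>\<^sub>v g"
        using all mult_mat_vec_carrier[OF S(1) v'] by blast
      obtain \<epsilon> where \<epsilon>: "\<epsilon> \<in> carrier_vec 1"
        and "mat_adjoint A *\<^sub>v (0\<^sub>v 1 @\<^sub>v v) = \<epsilon> @\<^sub>v (mat_adjoint N *\<^sub>v v)"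
        using low[OF zero_carrier_vec v] by blast
      then have "\<epsilon> @\<^sub>v (mat_adjoint N *\<^sub>v v) = \<mu> \<cdot>\<^sub>v (\<gamma> @\<^sub>v 0\<^sub>v n)"
        using aA_mult[OF v'] mu mult_mat_vec[OF Sa g, of \<mu>] Sg by simp
      also have "\<dots> = (\<mu> \<cdot>\<^sub>v \<gamma>) @\<^sub>v 0\<^sub>v n" using \<gamma> by (intro eq_vecI) auto
      finally show ?thesis using append_vec_eq[OF \<epsilon>] \<gamma> by simp
    qed
    then have "mat_adjoint N = 0\<^sub>m n n" by (rule mat_zero_if_kills_all[OF cN(2)])
    then have "N = 0\<^sub>m n n" using mat_adjoint_adjoint[of N] by simp
    then show ?thesis using congruent_to_diagonalizable_zero[OF a(1)] by simp
  qed
  from congruent_to_diagonalizable_block[OF N c this _ a(2)] a(1)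
  have "congruent_to_diagonalizable ?N b A" unfolding AF by simp
  then show ?case unfolding A_def by (rule congruent_to_diagonalizable_congruence[OF T S])
qed

section \<open>Block triangular matrices with a nilpotent corner\<close>

text \<open>
  If \<open>A (A v) = 0\<close>, then \<open>A\<^sup>* (A v) = 0\<close> and therefore \<open>\<parallel>A v\<parallel>\<^sup>2 = v\<^sup>* A\<^sup>* A v = 0\<close>. So all powers
  of \<open>A\<close> have the same kernel, which for nilpotent \<open>A\<close> is the whole space.
\<close>

lemma nilpotent_eq_zero_if_kernel_subset_adjoint_kernel:
  fixes A :: "complex mat"
  assumes A: "A \<in> carrier_mat n n" and nil: "nilpotent_mat A"
    and ker: "\<And>y. y \<in> carrier_vec n \<Longrightarrow> A *\<^sub>v y = 0\<^sub>v n \<Longrightarrow> mat_adjoint A *\<^sub>v y = 0\<^sub>v n"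
  shows "A = 0\<^sub>m n n"
proof -
  have step: "A *\<^sub>v v = 0\<^sub>v n" if v: "v \<in> carrier_vec n" and z: "A *\<^sub>v (A *\<^sub>v v) = 0\<^sub>v n" for v
  proof -
    have Av: "A *\<^sub>v v \<in> carrier_vec n" using A v by simp
    have "(A *\<^sub>v v) \<bullet>c (A *\<^sub>v v) = v \<bullet>c (mat_adjoint A *\<^sub>v (A *\<^sub>v v))"
      by (rule mat_adjoint_scalar_prod[OF A v Av])
    also have "\<dots> = 0" using ker[OF Av z] v by simp
    finally show ?thesis using Av by simp
  qed
  have pow: "A *\<^sub>v v = 0\<^sub>v n" if "v \<in> carrier_vec n" "(A ^\<^sub>m Suc j) *\<^sub>v v = 0\<^sub>v n" for j v
    using that
  proof (induction j arbitrary: v)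
    case 0
    then show ?case using A by simp
  next
    case (Suc j)
    have "(A ^\<^sub>m Suc j) *\<^sub>v (A *\<^sub>v v) = (A ^\<^sub>m Suc (Suc j)) *\<^sub>v v"
      using assoc_mult_mat_vec[OF pow_carrier_mat[OF A, of "Suc j"] A Suc.prems(1)] by simp
    then have "A *\<^sub>v (A *\<^sub>v v) = 0\<^sub>v n"
      using Suc.IH[OF mult_mat_vec_carrier[OF A Suc.prems(1)]] Suc.prems(2) by metis
    then show ?case by (rule step[OF Suc.prems(1)])
  qed
  obtain j where "A ^\<^sub>m j = 0\<^sub>m n n" using nil A unfolding nilpotent_mat_def by auto
  then have "A ^\<^sub>m Suc j = 0\<^sub>m n n" using A by simp
  moreover have "0\<^sub>m n n *\<^sub>v v = (0\<^sub>v n :: complex vec)" if "v \<in> carrier_vec n" for v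
    using that by (intro eq_vecI) auto
  ultimately have "A *\<^sub>v v = 0\<^sub>v n" if "v \<in> carrier_vec n" for v
    using pow[OF that, of j] that by metis
  then show ?thesis by (rule mat_zero_if_kills_all[OF A])
qed


text \<open>
  Each \<open>y\<close> in the kernel of \<open>T2\<close> extends to the kernel vector \<open>(x, y)\<close> of \<open>T\<close> with
  \<open>x = - T1\<^sup>-\<^sup>1 R y\<close>. If \<open>T\<^sup>*\<close> annihilates it, then \<open>T1\<^sup>* x = 0\<close>, so \<open>x = 0\<close>, \<open>R y = 0\<close> and \<open>T2\<^sup>* y = 0\<close>.
  If this happens for all \<open>y\<close>, then \<open>T2 = 0\<close> by the previous lemma, every \<open>y\<close> is in its kernel, and
  \<open>R = 0\<close>.
\<close>

lemma block_kernel_moved: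
  fixes T1 T2 R :: "complex mat"
  assumes T1: "T1 \<in> carrier_mat m m" "det T1 \<noteq> 0" and T2: "T2 \<in> carrier_mat p p" "nilpotent_mat T2"
    and R: "R \<in> carrier_mat m p" and ne: "R \<noteq> 0\<^sub>m m p \<or> T2 \<noteq> 0\<^sub>m p p"
    and T_def: "T = four_block_mat T1 R (0\<^sub>m p m) T2"
  obtains k where "k \<in> carrier_vec (m + p)" "T *\<^sub>v k = 0\<^sub>v (m + p)" "mat_adjoint T *\<^sub>v k \<noteq> 0\<^sub>v (m + p)"
proof (rule ccontr)
  assume "\<not> thesis"
  then have no: "mat_adjoint T *\<^sub>v k = 0\<^sub>v (m + p)" if "k \<in> carrier_vec (m + p)" "T *\<^sub>v k = 0\<^sub>v (m + p)" for k
    using that \<open>\<And>k. k \<in> carrier_vec (m + p) \<Longrightarrow> T *\<^sub>v k = 0\<^sub>v (m + p) \<Longrightarrow>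
      mat_adjoint T *\<^sub>v k \<noteq> 0\<^sub>v (m + p) \<Longrightarrow> thesis\<close> by metis
  obtain B where B: "B \<in> carrier_mat m m" "T1 * B = 1\<^sub>m m"
    using obtain_inverse_mat[OF T1] by metis
  have T1a: "mat_adjoint T1 \<in> carrier_mat m m" and Ra: "mat_adjoint R \<in> carrier_mat p m"
    and T2a: "mat_adjoint T2 \<in> carrier_mat p p" using T1 R T2 by simp_all
  have Ta: "mat_adjoint T = four_block_mat (mat_adjoint T1) (0\<^sub>m m p) (mat_adjoint R) (mat_adjoint T2)"
    unfolding T_def using mat_adjoint_four_block[OF T1(1) R zero_carrier_mat T2(1)] by simp
  have zs: "0\<^sub>v (m + p) = 0\<^sub>v m @\<^sub>v (0\<^sub>v p :: complex vec)" by (intro eq_vecI) auto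
  have key: "R *\<^sub>v y = 0\<^sub>v m \<and> mat_adjoint T2 *\<^sub>v y = 0\<^sub>v p" if y: "y \<in> carrier_vec p" and T2y: "T2 *\<^sub>v y = 0\<^sub>v p" for y
  proof -
    define r where "r = R *\<^sub>v y"
    have r: "r \<in> carrier_vec m" unfolding r_def using R y by simp
    define x where "x = B *\<^sub>v (- r)"
    have x: "x \<in> carrier_vec m" unfolding x_def using B r by simp
    have "T1 *\<^sub>v x = - r"
      unfolding x_def using assoc_mult_mat_vec[OF T1(1) B(1), of "- r"] B(2) r by simp
    then have top: "T1 *\<^sub>v x + R *\<^sub>v y = 0\<^sub>v m" using r unfolding r_def[symmetric] by simp
    have "0\<^sub>m p m *\<^sub>v x = 0\<^sub>v p" using x by (intro eq_vecI) auto
    then have "T *\<^sub>v (x @\<^sub>v y) = 0\<^sub>v (m + p)"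
      unfolding T_def zs four_block_mat_mult_vec[OF T1(1) R zero_carrier_mat T2(1) x y] top T2y by simp
    then have "mat_adjoint T *\<^sub>v (x @\<^sub>v y) = 0\<^sub>v m @\<^sub>v 0\<^sub>v p"
      using no[OF append_carrier_vec[OF x y]] zs by simp
    then have "(mat_adjoint T1 *\<^sub>v x + 0\<^sub>m m p *\<^sub>v y) @\<^sub>v (mat_adjoint R *\<^sub>v x + mat_adjoint T2 *\<^sub>v y) = 0\<^sub>v m @\<^sub>v 0\<^sub>v p"
      unfolding Ta four_block_mat_mult_vec[OF T1a zero_carrier_mat Ra T2a x y] .
    moreover have "mat_adjoint T1 *\<^sub>v x + 0\<^sub>m m p *\<^sub>v y \<in> carrier_vec m"
      by (intro add_carrier_vec mult_mat_vec_carrier[OF T1a x] mult_mat_vec_carrier[OF zero_carrier_mat y])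
    ultimately have e1: "mat_adjoint T1 *\<^sub>v x + 0\<^sub>m m p *\<^sub>v y = 0\<^sub>v m"
      and e2: "mat_adjoint R *\<^sub>v x + mat_adjoint T2 *\<^sub>v y = 0\<^sub>v p"
      using append_vec_eq[OF _ zero_carrier_vec] by blast+
    have "0\<^sub>m m p *\<^sub>v y = 0\<^sub>v m" using y by (intro eq_vecI) auto
    then have "mat_adjoint T1 *\<^sub>v x = 0\<^sub>v m" using e1 mult_mat_vec_carrier[OF T1a x] by simp
    then have x0: "x = 0\<^sub>v m"
      using mult_mat_vec_inj[OF T1a det_mat_adjoint_nz[OF T1] x zero_carrier_vec] mult_mat_zero_vec[OF T1a] by simp
    have "R *\<^sub>v y = 0\<^sub>v m"
      using top mult_mat_vec_carrier[OF R y] unfolding x0 mult_mat_zero_vec[OF T1(1)] by simp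
    moreover have "mat_adjoint T2 *\<^sub>v y = 0\<^sub>v p"
      using e2 mult_mat_vec_carrier[OF T2a y] unfolding x0 mult_mat_zero_vec[OF Ra] by simp
    ultimately show ?thesis ..
  qed
  have T20: "T2 = 0\<^sub>m p p"
    by (rule nilpotent_eq_zero_if_kernel_subset_adjoint_kernel[OF T2]) (use key in blast)
  have "R *\<^sub>v y = 0\<^sub>v m" if y: "y \<in> carrier_vec p" for y
  proof -
    have "T2 *\<^sub>v y = 0\<^sub>v p" unfolding T20 using y by (intro eq_vecI) auto
    then show ?thesis using key[OF y] by blast
  qed
  then have "R = 0\<^sub>m m p" by (rule mat_zero_if_kills_all[OF R])
  with T20 ne show False by simp
qed

theorem theorem2p1:
  fixes m p :: nat and T T1 T2 R :: "complex mat"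
  assumes "m \<ge> 1" and "p \<ge> 1"
    and "T1 \<in> carrier_mat m m" and "invertible_mat T1"
    and "T2 \<in> carrier_mat p p" and "nilpotent_mat T2"
    and "R \<in> carrier_mat m p"
    and "T = four_block_mat T1 R (0\<^sub>m p m) T2"
  shows "product_of_three (pos_semidef_mat (m + p)) T \<longleftrightarrow>
    (R \<noteq> 0\<^sub>m m p \<or> T2 \<noteq> 0\<^sub>m p p) \<or>
    (R = 0\<^sub>m m p \<and> T2 = 0\<^sub>m p p \<and> product_of_three (pos_def_mat m) T1)"
proof -
  note dT1 = det_nz_if_invertible[OF assms(3,4)]
  have Tc: "T \<in> carrier_mat (m + p) (m + p)"
    unfolding assms(8) by (rule four_block_carrier_mat[OF assms(3,5)])
  show ?thesis
  proof (cases "R \<noteq> 0\<^sub>m m p \<or> T2 \<noteq> 0\<^sub>m p p")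
    case True
    obtain k where k: "k \<in> carrier_vec (m + p)" "T *\<^sub>v k = 0\<^sub>v (m + p)" "mat_adjoint T *\<^sub>v k \<noteq> 0\<^sub>v (m + p)"
      by (rule block_kernel_moved[OF assms(3) dT1 assms(5,6,7) True assms(8)])
    have "congruent_to_diagonalizable (m + p) 1 T"
      by (rule congruent_to_diagonalizable_if_kernel_moved[OF Tc k]) simp
    then have "product_of_three (pos_semidef_mat (m + p)) T"
      by (rule product_of_three_if_congruent_to_diagonalizable[OF Tc])
    with True show ?thesis by blast
  next
    case False
    then have R0: "R = 0\<^sub>m m p" and T20: "T2 = 0\<^sub>m p p" by simp_all
    define X where "X = mat m (m + p) (\<lambda>(i, j). if i = j then 1 else 0 :: complex)"
    have X: "X \<in> carrier_mat m (m + p)" by (simp add: X_def)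
    have aX: "mat_adjoint X = mat (m + p) m (\<lambda>(i, j). if i = j then 1 else 0)"
      by (intro eq_matI) (auto simp: X_def)
    have XX: "X * mat_adjoint X = 1\<^sub>m m"
      unfolding aX unfolding X_def
      by (intro eq_matI) (auto simp: scalar_prod_def if_distrib[of "\<lambda>y. y * _"] cong: if_cong)
    have "mat_adjoint X * T1 = mat (m + p) m (\<lambda>(i, j). if i < m then T1 $$ (i, j) else 0)"
      unfolding aX using assms(3)
      by (intro eq_matI) (auto simp: scalar_prod_def if_distrib[of "\<lambda>y. y * _"] cong: if_cong)
    then have "mat_adjoint X * T1 * X = T"
      unfolding assms(8) R0 T20 X_def using assms(3)
      by (intro eq_matI) (auto simp: scalar_prod_def if_distrib[of "\<lambda>y. _ * y"] cong: if_cong)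
    then show ?thesis
      using product_of_three_compression[OF X XX assms(3) dT1] R0 T20 by simp
  qed
qed

end
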